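(* Let $\mathcal{H}$ be a complex Hilbert space and let $x,y\in\mathcal{H}$. Then $$|\langle x,y\rangle|\le \left(\int_{0}^{1}\left|te^{i\theta}+(1-t)e^{-i\theta}\right|dt\right)\|x\|\,\|y\|\le \|x\|\,\|y\|,$$ where $\theta=\angle_{x,y}$.
   Context: For vectors $x,y\in\mathcal{H}$, the angle between $x$ and $y$ is defined by $\angle_{x,y}=\cos^{-1}\left(\frac{|\langle x,y\rangle|}{\|x\|\,\|y\|}\right)$, where it is understood that $0\le\angle_{x,y}\le\pi$. *)

theory Defs
  imports "HOL-Analysis.Analysis"
begin

class scaleC =
  fixes scaleC :: "complex \<Rightarrow> 'a \<Rightarrow> 'a"  (infixr "*\<^sub>C" 75)

text \<open>Building on \<^class>\<open>real_vector\<close> makes the library's norm and completeness available;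
  \<open>scaleR_scaleC\<close> says that the real structure is the restriction of the complex one.\<close>

class complex_vector = real_vector + scaleC +
  assumes scaleC_add_right: "a *\<^sub>C (x + y) = a *\<^sub>C x + a *\<^sub>C y"
    and scaleC_add_left: "(a + b) *\<^sub>C x = a *\<^sub>C x + b *\<^sub>C x"
    and scaleC_scaleC: "a *\<^sub>C (b *\<^sub>C x) = (a * b) *\<^sub>C x"
    and scaleC_one: "1 *\<^sub>C x = x"
    and scaleR_scaleC: "r *\<^sub>R x = complex_of_real r *\<^sub>C x"

text \<open>The inner product is linear in the first and conjugate-linear in the second argument.
  By \<open>cinner_commute\<close> the values \<open>cinner x x\<close> are real, so \<open>Re\<close> loses nothing.
  The normed-space axioms follow from the others; they are inherited only to reuse the library norm.\<close>

class complex_inner = complex_vector + real_normed_vector +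
  fixes cinner :: "'a \<Rightarrow> 'a \<Rightarrow> complex"
  assumes cinner_commute: "cinner x y = cnj (cinner y x)"
    and cinner_add_left: "cinner (x + y) z = cinner x z + cinner y z"
    and cinner_scaleC_left: "cinner (a *\<^sub>C x) y = a * cinner x y"
    and cinner_ge_zero: "0 \<le> Re (cinner x x)"
    and cinner_eq_zero_iff: "cinner x x = 0 \<longleftrightarrow> x = 0"
    and norm_eq_sqrt_cinner: "norm x = sqrt (Re (cinner x x))"

class complex_hilbert_space = complex_inner + complete_space

instantiation complex :: complex_hilbert_space
begin

definition scaleC_complex :: "complex \<Rightarrow> complex \<Rightarrow> complex"
  where "scaleC_complex a x = a * x"

definition cinner_complex :: "complex \<Rightarrow> complex \<Rightarrow> complex"
  where "cinner_complex x y = x * cnj y"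

instance
  by standard
    (auto simp: scaleC_complex_def cinner_complex_def algebra_simps scaleR_conv_of_real
      cmod_def power2_eq_square complex_eq_iff)

end

text \<open>If \<open>x = 0\<close> or \<open>y = 0\<close> the quotient is \<open>0\<close>, so the angle is \<open>pi / 2\<close> by convention.\<close>

definition angle :: "'a::complex_inner \<Rightarrow> 'a \<Rightarrow> real"
  where "angle x y = arccos (cmod (cinner x y) / (norm x * norm y))"

end

theory Submission
  imports Defs
begin

text \<open>The integrand is the modulus of a point on the chord that joins \<open>e\<^sup>i\<^sup>\<theta>\<close> and its conjugate.
  This chord is vertical, so each of its points has real part \<open>cos \<theta>\<close>, and it lies in the closed
  unit disc, which is convex. Hence the integrand is between \<open>cos \<theta>\<close> and \<open>1\<close>, and so is its mean
  over \<open>[0, 1]\<close>. By the Cauchy--Schwarz inequality the quotient in the definition of the angle is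
  in the domain of \<open>arccos\<close>, which gives \<open>cos \<theta> * (norm x * norm y) = cmod (cinner x y)\<close>;
  multiplying the bounds for the mean by \<open>norm x * norm y\<close> yields both inequalities.\<close>

lemma cinner_add_right:
  fixes x y z :: "'a::complex_inner"
  shows "cinner x (y + z) = cinner x y + cinner x z"
  by (metis cinner_commute cinner_add_left complex_cnj_add)

lemma cinner_scaleC_right:
  fixes x y :: "'a::complex_inner"
  shows "cinner x (a *\<^sub>C y) = cnj a * cinner x y"
  by (metis cinner_commute cinner_scaleC_left complex_cnj_mult)

lemma cinner_self:
  fixes x :: "'a::complex_inner"
  shows "cinner x x = complex_of_real ((norm x)\<^sup>2)"
proof (rule complex_eqI)
  show "Re (cinner x x) = Re (complex_of_real ((norm x)\<^sup>2))"
    by (simp add: norm_eq_sqrt_cinner cinner_ge_zero)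
  show "Im (cinner x x) = Im (complex_of_real ((norm x)\<^sup>2))"
    using arg_cong[OF cinner_commute[of x x], of Im] by simp
qed

text \<open>The vector \<open>z\<close> below is the component of \<open>x\<close> orthogonal to \<open>y\<close>, scaled by \<open>(norm y)\<^sup>2\<close> to
  avoid a division; the inequality says that its squared norm is nonnegative.\<close>

lemma cmod_cinner_le_norm:
  fixes x y :: "'a::complex_inner"
  shows "cmod (cinner x y) \<le> norm x * norm y"
proof (cases "y = 0")
  case True
  have "cinner x (0 + 0) = cinner x 0 + cinner x 0"
    by (rule cinner_add_right)
  then show ?thesis
    using True by simp
next
  case False
  define n where "n = (norm y)\<^sup>2"
  define a where "a = cinner x y"
  define z where "z = complex_of_real n *\<^sub>C x + (- a) *\<^sub>C y"
  have n: "n > 0"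
    using False by (simp add: n_def)
  have yx: "cinner y x = cnj a"
    unfolding a_def by (rule cinner_commute)
  have "cinner z z = complex_of_real n * (complex_of_real n * complex_of_real ((norm x)\<^sup>2) - a * cnj a)"
    unfolding z_def cinner_add_left cinner_add_right cinner_scaleC_left cinner_scaleC_right
      cinner_self[of x] cinner_self[of y] yx a_def[symmetric] n_def[symmetric]
    by (simp add: algebra_simps)
  also have "\<dots> = complex_of_real (n * (n * (norm x)\<^sup>2 - (cmod a)\<^sup>2))"
    by (simp add: complex_norm_square[symmetric])
  finally have "Re (cinner z z) = n * (n * (norm x)\<^sup>2 - (cmod a)\<^sup>2)"
    by simp
  with cinner_ge_zero[of z] n have "(cmod a)\<^sup>2 \<le> n * (norm x)\<^sup>2"
    by (simp add: zero_le_mult_iff)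
  then have "(cmod a)\<^sup>2 \<le> (norm x * norm y)\<^sup>2"
    by (simp add: n_def power_mult_distrib mult.commute)
  then show ?thesis
    unfolding a_def by (rule power2_le_imp_le) simp
qed

lemma cos_angle_mult_norms:
  fixes x y :: "'a::complex_inner"
  shows "cos (angle x y) * (norm x * norm y) = cmod (cinner x y)"
proof -
  have "cmod (cinner x y) / (norm x * norm y) \<le> 1"
    using cmod_cinner_le_norm[of x y] by (auto simp: divide_le_eq_1 zero_less_mult_iff)
  then have "cos (angle x y) = cmod (cinner x y) / (norm x * norm y)"
    unfolding angle_def by (intro cos_arccos) (auto intro: order_trans[of _ 0])
  \<comment> \<open>If a norm vanishes, the quotient is \<open>0\<close>, and Cauchy--Schwarz makes the inner product vanish too.\<close>
  then show ?thesis
    using cmod_cinner_le_norm[of x y] by auto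
qed

lemma cos_le_cmod_chord:
  "cos \<theta> \<le> cmod (complex_of_real t * exp (\<i> * complex_of_real \<theta>)
            + (1 - complex_of_real t) * exp (- (\<i> * complex_of_real \<theta>)))" (is "_ \<le> cmod ?p")
proof -
  have "Re ?p = cos \<theta>"
    by (simp add: Re_exp algebra_simps)
  then show ?thesis
    using complex_Re_le_cmod[of ?p] by simp
qed

lemma cmod_chord_le_1:
  assumes "0 \<le> t" "t \<le> 1"
  shows "cmod (complex_of_real t * exp (\<i> * complex_of_real \<theta>)
            + (1 - complex_of_real t) * exp (- (\<i> * complex_of_real \<theta>))) \<le> 1"
proof -
  have "cmod (1 - complex_of_real t) = 1 - t"
    using assms by (metis abs_of_nonneg diff_ge_0_iff_ge norm_of_real of_real_1 of_real_diff)
  then show ?thesis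
    using assms by (intro norm_triangle_le) (simp add: norm_mult)
qed

lemma integral_unit_interval_bounds:
  fixes f :: "real \<Rightarrow> real"
  assumes "f integrable_on {0..1}" and "\<And>t. t \<in> {0..1} \<Longrightarrow> a \<le> f t \<and> f t \<le> b"
  shows "a \<le> integral {0..1} f \<and> integral {0..1} f \<le> b"
  using integral_le[of "\<lambda>_. a" "{0..1}" f] integral_le[of f "{0..1}" "\<lambda>_. b"] assms
  by auto

theorem corollary2p1:
  fixes x y :: "'a::complex_hilbert_space" and \<theta> :: real
  assumes "\<theta> = angle x y"
  shows "cmod (cinner x y)
      \<le> integral {0..1} (\<lambda>t::real. cmod (complex_of_real t * exp (\<i> * complex_of_real \<theta>)
            + (1 - complex_of_real t) * exp (- (\<i> * complex_of_real \<theta>)))) * (norm x * norm y)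
    \<and> integral {0..1} (\<lambda>t::real. cmod (complex_of_real t * exp (\<i> * complex_of_real \<theta>)
            + (1 - complex_of_real t) * exp (- (\<i> * complex_of_real \<theta>)))) * (norm x * norm y)
      \<le> norm x * norm y"
    (is "_ \<le> integral _ ?f * _ \<and> _")
proof -
  have "?f integrable_on {0..1}"
    by (intro integrable_continuous_real continuous_intros)
  then have I: "cos \<theta> \<le> integral {0..1} ?f \<and> integral {0..1} ?f \<le> 1"
    by (rule integral_unit_interval_bounds) (simp add: cos_le_cmod_chord cmod_chord_le_1)
  have "cmod (cinner x y) = cos \<theta> * (norm x * norm y)"
    using assms by (simp add: cos_angle_mult_norms)
  also have "\<dots> \<le> integral {0..1} ?f * (norm x * norm y)"
    using I by (intro mult_right_mono) auto
  finally have "cmod (cinner x y) \<le> integral {0..1} ?f * (norm x * norm y)" .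
  moreover have "integral {0..1} ?f * (norm x * norm y) \<le> 1 * (norm x * norm y)"
    using I by (intro mult_right_mono) auto
  ultimately show ?thesis
    by simp
qed

end
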